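(* Let $C=\{x\in\mathbb{R}^n:x>0\}$, $\mathcal{M}=\{x\in\mathbb{R}^n:Ax=b\}$, let $\phi$ be a separable kernel as described in the context, and let $\eta>0$. Then the fixed point set $\{x\in\mathcal{M}\cap\overline{C}:x\in\overline{T}_\eta(x)\}$ of the extended mirror-descent update mapping $\overline{T}_\eta$ equals the stable set $\mathcal{S}$ of the differential inclusion $\dot x(t)\in-\mathrm{P}_{T_{x(t)}\mathcal{M}}\nabla^2\phi(x(t))^{-1}\partial f(x(t))$, $x(0)\in \mathcal{M}\cap C$.
   Context: $f:\mathbb{R}^n\to\mathbb{R}$ is locally Lipschitz, $\partial f$ its Clarke subdifferential; $A\in\mathbb{R}^{m\times n}$ has full row rank. Kernel: $\phi(x)=\sum_{i=1}^n\phi_i(x_i)$, where each $\phi_i$ is differentiable and strictly convex on $(0,\infty)$ with $|\phi_i'(t)|\to\infty$ as $t\to0^+$, and there exist $\gamma>0$ and continuous $\psi_i:\mathbb{R}\to(0,\infty)$ with $\phi_i''(t)=t^{-\gamma}\psi_i(t)$ for $t>0$. Thus $\nabla^2\phi(x)^{-1}=\mathrm{Diag}(x_i^\gamma\psi_i(x_i)^{-1})$, which extends continuously to $\overline{C}$. The Bregman distance of $\phi_i$ is $D_{\phi_i}(s,t)=\phi_i(s)-\phi_i(t)-\phi_i'(t)(s-t)$. For $x\in\mathcal{M}\cap\overline{C}$ let $\mathcal{I}(x)=\{i:x_i>0\}$ and $\mathcal{J}(x)=\{j:x_j=0\}$. The (set-valued) extended update mapping is: $z\in\overline{T}_\eta(x)$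 iff for some $d\in\partial f(x)$, $$z\in\arg\min_y\Big\{\langle d,y\rangle+\frac1\eta\sum_{i\in\mathcal{I}(x)}D_{\phi_i}(y_i,x_i):\ y_{\mathcal{J}(x)}=x_{\mathcal{J}(x)},\ Ay=b,\ y\ge0\Big\}.$$ $\mathrm{P}_{T_x\mathcal{M}}$ is the projection onto $T_x\mathcal{M}=\{z:Az=0\}$ in the metric $u^T\nabla^2\phi(x)v$. The stable set is $\mathcal{S}=\{x\in\mathcal{M}\cap\overline{C}:0\in\mathrm{P}_{T_x\mathcal{M}}\nabla^2\phi(x)^{-1}\partial f(x)\}$, which by the paper's convention (also at boundary points) is the set $\{x\in\mathcal{M}\cap\overline{C}:0\in\nabla^2\phi(x)^{-1}(\partial f(x)+\mathrm{range}(A^T))\}$. *)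

theory Defs
  imports "HOL-Analysis.Analysis"
begin

definition locally_lipschitz :: "('a::metric_space \<Rightarrow> real) \<Rightarrow> bool" where
  "locally_lipschitz f \<longleftrightarrow> (\<forall>x. \<exists>e>0. \<exists>L. L-lipschitz_on (ball x e) f)"

(* Clarke's generalized directional derivative: the upper limit of
   (f (y + t v) - f y) / t as y tends to x (y = x allowed) and t decreases to 0. *)
definition clarke_dd :: "('a::real_normed_vector \<Rightarrow> real) \<Rightarrow> 'a \<Rightarrow> 'a \<Rightarrow> ereal" where
  "clarke_dd f x v =
     Limsup (nhds x \<times>\<^sub>F at_right 0) (\<lambda>(y, t). ereal ((f (y + t *\<^sub>R v) - f y) / t))"

definition clarke_subdiff :: "('a::real_inner \<Rightarrow> real) \<Rightarrow> 'a \<Rightarrow> 'a set" where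
  "clarke_subdiff f x = {d. \<forall>v. ereal (d \<bullet> v) \<le> clarke_dd f x v}"

definition strictly_convex_on :: "real set \<Rightarrow> (real \<Rightarrow> real) \<Rightarrow> bool" where
  "strictly_convex_on S g \<longleftrightarrow> convex S \<and>
     (\<forall>x\<in>S. \<forall>y\<in>S. \<forall>u. x \<noteq> y \<longrightarrow> 0 < u \<longrightarrow> u < 1 \<longrightarrow>
        g ((1 - u) * x + u * y) < (1 - u) * g x + u * g y)"

(* Only the values of the components on the open half-line matter; the exponent \<gamma> is
   common to all components. *)
definition separable_kernel :: "('n::finite \<Rightarrow> real \<Rightarrow> real) \<Rightarrow> bool" where
  "separable_kernel \<phi> \<longleftrightarrow>
     (\<forall>i. (\<phi> i) differentiable_on {0<..} \<and> strictly_convex_on {0<..} (\<phi> i) \<and>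
          filterlim (\<lambda>t. \<bar>deriv (\<phi> i) t\<bar>) at_top (at_right 0)) \<and>
     (\<exists>\<gamma>>0. \<exists>\<psi>::'n \<Rightarrow> real \<Rightarrow> real. \<forall>i.
          continuous_on UNIV (\<psi> i) \<and> (\<forall>t. \<psi> i t > 0) \<and>
          (\<forall>t>0. (deriv (\<phi> i) has_real_derivative t powr (- \<gamma>) * \<psi> i t) (at t)))"

definition separable_sum :: "('n::finite \<Rightarrow> real \<Rightarrow> real) \<Rightarrow> real^'n \<Rightarrow> real" where
  "separable_sum \<phi> x = (\<Sum>i\<in>UNIV. \<phi> i (x $ i))"

definition positive_orthant :: "(real^'n) set" where
  "positive_orthant = {x. \<forall>i. 0 < x $ i}"

definition affine_constraint :: "real^'n^'m \<Rightarrow> real^'m \<Rightarrow> (real^'n) set" where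
  "affine_constraint A b = {x. A *v x = b}"

definition hessian :: "(real^'n \<Rightarrow> real) \<Rightarrow> real^'n \<Rightarrow> real^'n^'n" where
  "hessian g x =
     (\<chi> i j. deriv (\<lambda>s. deriv (\<lambda>t. g (x + s *\<^sub>R axis i 1 + t *\<^sub>R axis j 1)) 0) 0)"

(* Inverse Hessian of the kernel on the open orthant, extended by continuity to its closure.
   For a kernel this is Diag (x_i powr \<gamma> / \<psi>_i (x_i)), with entries 0 where x_i = 0. *)
definition inv_hessian_ext :: "('n::finite \<Rightarrow> real \<Rightarrow> real) \<Rightarrow> real^'n \<Rightarrow> real^'n^'n" where
  "inv_hessian_ext \<phi> x =
     (if x \<in> positive_orthant then matrix_inv (hessian (separable_sum \<phi>) x)
      else Lim (at x within positive_orthant) (\<lambda>y. matrix_inv (hessian (separable_sum \<phi>) y)))"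

(* Lower semicontinuous extension of a convex function from the open half-line to the real
   line. For a convex g the lower limit at 0 is the limit, finite or infinite, as for
   t ln t and - ln t. *)
definition lsc_ext :: "(real \<Rightarrow> real) \<Rightarrow> real \<Rightarrow> ereal" where
  "lsc_ext g s = (if s > 0 then ereal (g s)
     else if s = 0 then Liminf (at_right 0) (\<lambda>t. ereal (g t)) else \<infinity>)"

definition bregman :: "(real \<Rightarrow> real) \<Rightarrow> real \<Rightarrow> real \<Rightarrow> ereal" where
  "bregman g s t = lsc_ext g s - ereal (g t) - ereal (deriv g t * (s - t))"

definition ext_update ::
  "('n::finite \<Rightarrow> real \<Rightarrow> real) \<Rightarrow> (real^'n \<Rightarrow> real) \<Rightarrow> real^'n^'m \<Rightarrow> real^'m \<Rightarrow> real \<Rightarrow> real^'n \<Rightarrow> (real^'n) set"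
  where
  "ext_update \<phi> f A b \<eta> x =
     {z. \<exists>d\<in>clarke_subdiff f x.
        is_arg_min
          (\<lambda>y. ereal (d \<bullet> y) + ereal (1 / \<eta>) * (\<Sum>i\<in>{i. x $ i > 0}. bregman (\<phi> i) (y $ i) (x $ i)))
          (\<lambda>y. (\<forall>j. x $ j = 0 \<longrightarrow> y $ j = x $ j) \<and> A *v y = b \<and> (\<forall>i. 0 \<le> y $ i))
          z}"

(* Points where 0 belongs to P \<nabla>\<^sup>2\<phi>(x)^(-1) \<partial>f(x), P being the projection onto the kernel of A in
   the metric of the Hessian. As that metric is defined on the open orthant only, the condition
   is read on the whole closure as: 0 belongs to \<nabla>\<^sup>2\<phi>(x)^(-1) (\<partial>f(x) + range (A^T)). *)
definition stable_set ::
  "('n::finite \<Rightarrow> real \<Rightarrow> real) \<Rightarrow> (real^'n \<Rightarrow> real) \<Rightarrow> real^'n^'m \<Rightarrow> real^'m \<Rightarrow> (real^'n) set"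
  where
  "stable_set \<phi> f A b =
     {x \<in> affine_constraint A b \<inter> closure positive_orthant.
        0 \<in> (\<lambda>v. inv_hessian_ext \<phi> x *v v) `
              {d + w | d w. d \<in> clarke_subdiff f x \<and> w \<in> range (\<lambda>l. transpose A *v l)}}"

end

theory Submission
  imports Defs
begin

text \<open>
  Both sides of the equation ask, at a point \<open>x \<ge> 0\<close> of the affine space, for a Clarke subgradient \<open>d\<close>
  and a multiplier \<open>l\<close> such that \<open>d + A\<^sup>T l\<close> vanishes at every index \<open>i\<close> with \<open>x\<^sub>i > 0\<close>. The
  argument treats one \<open>d\<close> at a time.

  For the stable set this is a computation of the extended inverse Hessian. The Hessian of a
  separable kernel is diagonal with entries \<open>x\<^sub>i powr (- \<gamma>) * \<psi>\<^sub>i(x\<^sub>i)\<close>, so its inverse has the entries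
  \<open>x\<^sub>i powr \<gamma> / \<psi>\<^sub>i(x\<^sub>i)\<close>. Because \<open>\<gamma> > 0\<close> and \<open>\<psi>\<^sub>i\<close> is continuous and positive up to \<open>0\<close>, this formula
  gives the limit at boundary points, where the entries with \<open>x\<^sub>i = 0\<close> vanish and the others
  do not (\<open>inv_hessian_ext_eq\<close>). Hence the kernel of the matrix consists of the vectors that vanish
  wherever \<open>x\<close> is positive.

  For the update it is the optimality condition of the minimisation problem that defines it
  (\<open>is_arg_min_self_iff\<close>). Sufficiency: if such an \<open>l\<close> exists, then the linear term is constant on the
  feasible set, while a Bregman distance is nonnegative and zero at \<open>x\<close>. Necessity: Bregman distances have derivative
  zero at \<open>x\<close>, so \<open>d\<close> annihilates every \<open>v\<close> in the kernel of \<open>A\<close> that vanishes off the support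
  of \<open>x\<close>; both \<open>x + t v\<close> and \<open>x - t v\<close> are feasible for small \<open>t\<close>, so no inequality multipliers appear.
  The annihilator of an intersection of subspaces is the sum of the annihilators
  (\<open>annihilator_of_kernel_on_face\<close>), which yields \<open>l\<close>.
\<close>

section \<open>Orthants\<close>

lemma closure_positive_orthant:
  "closure positive_orthant = {x::real^'n. \<forall>i. 0 \<le> x $ i}"
proof
  have "closed {x::real^'n. \<forall>i. 0 \<le> x $ i}"
    by (intro closed_Collect_all closed_Collect_le continuous_intros)
  then show "closure positive_orthant \<subseteq> {x::real^'n. \<forall>i. 0 \<le> x $ i}"
    by (intro closure_minimal) (auto simp: positive_orthant_def less_imp_le)
next
  show "{x::real^'n. \<forall>i. 0 \<le> x $ i} \<subseteq> closure positive_orthant"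
  proof
    fix x :: "real^'n" assume x: "x \<in> {x. \<forall>i. 0 \<le> x $ i}"
    define X where "X n = x + inverse (real (Suc n)) *\<^sub>R (\<chi> i. 1)" for n
    have "X n \<in> positive_orthant" for n
      using x by (auto simp: X_def positive_orthant_def intro!: add_nonneg_pos)
    moreover have "X \<longlonglongrightarrow> x + 0 *\<^sub>R (\<chi> i. 1)"
      unfolding X_def by (intro tendsto_intros LIMSEQ_inverse_real_of_nat)
    ultimately show "x \<in> closure positive_orthant"
      by (auto simp: closure_sequential)
  qed
qed

text \<open>
  Used with all coordinates, to differentiate near an interior point, and with the support of a
  boundary point, to move inside the face of the orthant that it spans.
\<close>
lemma eventually_positive_coordinates:
  fixes x :: "real^'n"
  assumes "\<And>i. i \<in> I \<Longrightarrow> 0 < x $ i"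
  shows "\<forall>\<^sub>F t in nhds 0. \<forall>i\<in>I. 0 < (x + t *\<^sub>R v) $ i"
proof -
  have "\<forall>\<^sub>F t in nhds 0. 0 < (x + t *\<^sub>R v) $ i" if "i \<in> I" for i
  proof -
    have "((\<lambda>t. (x + t *\<^sub>R v) $ i) \<longlongrightarrow> (x + 0 *\<^sub>R v) $ i) (nhds 0)"
      by (intro tendsto_intros filterlim_ident)
    then show ?thesis
      using assms[OF that] by (intro order_tendstoD(1)) auto
  qed
  then show ?thesis
    by (intro eventually_ball_finite) auto
qed

section \<open>The inverse Hessian of a separable kernel\<close>

text \<open>
  The Hessian is an iterated one-variable derivative. The inner derivative has to be known at all
  points near \<open>x\<close> on the line along which the outer one is taken, hence openness of the orthant enters.
\<close>
lemma hessian_separable_sum: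
  fixes x :: "real^'n"
  assumes x: "x \<in> positive_orthant"
    and D1: "\<And>i t. t > 0 \<Longrightarrow> (\<phi> i has_real_derivative deriv (\<phi> i) t) (at t)"
    and D2: "\<And>i t. t > 0 \<Longrightarrow> (deriv (\<phi> i) has_real_derivative \<kappa> i t) (at t)"
  shows "hessian (separable_sum \<phi>) x = (\<chi> i j. if i = j then \<kappa> i (x $ i) else 0)"
proof -
  have inner: "deriv (\<lambda>t. separable_sum \<phi> (z + t *\<^sub>R axis j 1)) 0 = deriv (\<phi> j) (z $ j)"
    if z: "z \<in> positive_orthant" for z :: "real^'n" and j
  proof -
    have "((\<lambda>t. \<phi> k (z $ k + t * axis j 1 $ k)) has_real_derivative
        deriv (\<phi> k) (z $ k) * axis j 1 $ k) (at 0)" for k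
    proof (rule DERIV_chain2[where f = "\<phi> k"])
      show "(\<phi> k has_real_derivative deriv (\<phi> k) (z $ k)) (at (z $ k + 0 * axis j 1 $ k))"
        using D1[of "z $ k" k] z by (simp add: positive_orthant_def)
    qed (auto intro!: derivative_eq_intros)
    then have "((\<lambda>t. separable_sum \<phi> (z + t *\<^sub>R axis j 1)) has_real_derivative
        (\<Sum>k\<in>UNIV. deriv (\<phi> k) (z $ k) * axis j 1 $ k)) (at 0)"
      unfolding separable_sum_def by (intro DERIV_sum) simp
    moreover have "(\<Sum>k\<in>UNIV. deriv (\<phi> k) (z $ k) * axis j 1 $ k) = deriv (\<phi> j) (z $ j)"
      by (simp add: axis_def if_distrib[of "(*) _"] cong: if_cong)
    ultimately show ?thesis
      by (simp add: DERIV_imp_deriv)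
  qed
  have "deriv (\<lambda>s. deriv (\<lambda>t. separable_sum \<phi> (x + s *\<^sub>R axis i 1 + t *\<^sub>R axis j 1)) 0) 0
      = (if i = j then \<kappa> i (x $ i) else 0)" for i j
  proof -
    have "\<forall>\<^sub>F s in nhds 0. x + s *\<^sub>R axis i 1 \<in> positive_orthant"
      using eventually_positive_coordinates[of UNIV x "axis i 1"] x
      by (simp add: positive_orthant_def)
    then have "\<forall>\<^sub>F s in nhds 0. deriv (\<lambda>t. separable_sum \<phi> (x + s *\<^sub>R axis i 1 + t *\<^sub>R axis j 1)) 0
        = deriv (\<phi> j) (x $ j + s * axis i 1 $ j)"
      by eventually_elim (simp add: inner)
    then have "deriv (\<lambda>s. deriv (\<lambda>t. separable_sum \<phi> (x + s *\<^sub>R axis i 1 + t *\<^sub>R axis j 1)) 0) 0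
        = deriv (\<lambda>s. deriv (\<phi> j) (x $ j + s * axis i 1 $ j)) 0"
      by (rule deriv_cong_ev) simp
    also have "((\<lambda>s. deriv (\<phi> j) (x $ j + s * axis i 1 $ j)) has_real_derivative
        \<kappa> j (x $ j) * axis i 1 $ j) (at 0)"
    proof (rule DERIV_chain2[where f = "deriv (\<phi> j)"])
      show "(deriv (\<phi> j) has_real_derivative \<kappa> j (x $ j)) (at (x $ j + 0 * axis i 1 $ j))"
        using D2[of "x $ j" j] x by (simp add: positive_orthant_def)
    qed (auto intro!: derivative_eq_intros)
    then have "deriv (\<lambda>s. deriv (\<phi> j) (x $ j + s * axis i 1 $ j)) 0 = \<kappa> j (x $ j) * axis i 1 $ j"
      by (rule DERIV_imp_deriv)
    also have "\<dots> = (if i = j then \<kappa> i (x $ i) else 0)"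
      by (simp add: axis_def)
    finally show ?thesis .
  qed
  then show ?thesis
    by (simp add: hessian_def)
qed

lemma matrix_inv_diagonal:
  fixes c :: "'n::finite \<Rightarrow> real"
  assumes c: "\<And>i. c i \<noteq> 0"
  shows "matrix_inv (\<chi> i j. if i = j then c i else 0) = (\<chi> i j. if i = j then inverse (c i) else 0)"
    (is "matrix_inv ?D = ?E")
proof -
  have E: "?D ** ?E = mat 1" "?E ** ?D = mat 1"
    using c by (auto simp: matrix_matrix_mult_def mat_def vec_eq_iff if_distrib[of "\<lambda>x. x * _"]
        cong: if_cong)
  have "?D ** matrix_inv ?D = mat 1 \<and> matrix_inv ?D ** ?D = mat 1"
    unfolding matrix_inv_def by (rule someI[of _ ?E]) (intro conjI E)
  then have "?E ** (?D ** matrix_inv ?D) = ?E"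
    by (simp only: matrix_mul_rid)
  then show ?thesis
    by (simp only: matrix_mul_assoc E(2) matrix_mul_lid)
qed

text \<open>
  The formula for the inverse Hessian in the open orthant is continuous on the closed orthant: this is
  where \<open>\<gamma> > 0\<close> is used, since then \<open>t powr \<gamma>\<close> tends to \<open>0 = 0 powr \<gamma>\<close> as \<open>t\<close> decreases to \<open>0\<close>.
\<close>
lemma inv_hessian_ext_eq:
  fixes x :: "real^'n"
  assumes x: "\<And>i. 0 \<le> x $ i"
    and D1: "\<And>i t. t > 0 \<Longrightarrow> (\<phi> i has_real_derivative deriv (\<phi> i) t) (at t)"
    and D2: "\<And>i t. t > 0 \<Longrightarrow> (deriv (\<phi> i) has_real_derivative t powr (- \<gamma>) * \<psi> i t) (at t)"
    and \<gamma>: "\<gamma> > 0"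
    and \<psi>: "\<And>i. continuous_on UNIV (\<psi> i)" "\<And>i t. \<psi> i t > 0"
  shows "inv_hessian_ext \<phi> x = (\<chi> i j. if i = j then (x $ i) powr \<gamma> / \<psi> i (x $ i) else 0)"
proof -
  define F :: "real^'n \<Rightarrow> real^'n^'n"
    where "F y = (\<chi> i j. if i = j then (y $ i) powr \<gamma> / \<psi> i (y $ i) else 0)" for y
  have F: "matrix_inv (hessian (separable_sum \<phi>) y) = F y" if y: "y \<in> positive_orthant" for y
  proof -
    have "(y $ i) powr (- \<gamma>) * \<psi> i (y $ i) \<noteq> 0" for i
      using y \<psi>(2)[of i "y $ i"] by (auto simp: positive_orthant_def less_le)
    then show ?thesis
      by (simp add: hessian_separable_sum[where \<kappa> = "\<lambda>i t. t powr (- \<gamma>) * \<psi> i t", OF y D1 D2]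
          matrix_inv_diagonal F_def powr_minus divide_inverse vec_eq_iff)
  qed
  show ?thesis
  proof (cases "x \<in> positive_orthant")
    case True
    then show ?thesis
      using F[OF True] by (simp add: inv_hessian_ext_def F_def)
  next
    case False
    have "x \<in> closure positive_orthant"
      using x by (simp add: closure_positive_orthant)
    \<comment> \<open>The limit is unique as \<open>x\<close> is an accumulation point of the orthant.\<close>
    with False have nt: "at x within positive_orthant \<noteq> bot"
      by (auto simp: closure_def trivial_limit_within)
    have pos: "\<forall>\<^sub>F y in at x within positive_orthant. y \<in> positive_orthant"
      by (simp add: eventually_at_filter)
    have "((\<lambda>y. (y $ i) powr \<gamma> / \<psi> i (y $ i)) \<longlongrightarrow> (x $ i) powr \<gamma> / \<psi> i (x $ i))
        (at x within positive_orthant)" for i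
    proof (intro tendsto_divide tendsto_powr2)
      show "((\<lambda>y. \<psi> i (y $ i)) \<longlongrightarrow> \<psi> i (x $ i)) (at x within positive_orthant)"
        using \<psi>(1)[of i]
        by (intro continuous_on_tendsto_compose[of UNIV "\<psi> i"] tendsto_intros) auto
      show "\<psi> i (x $ i) \<noteq> 0"
        using \<psi>(2)[of i "x $ i"] by simp
      show "\<forall>\<^sub>F y in at x within positive_orthant. 0 \<le> y $ i"
        using pos by eventually_elim (simp add: positive_orthant_def less_imp_le)
    qed (use \<gamma> in \<open>auto intro!: tendsto_intros\<close>)
    then have "(F \<longlongrightarrow> F x) (at x within positive_orthant)"
      unfolding F_def by (intro vec_tendstoI) simp
    moreover have "\<forall>\<^sub>F y in at x within positive_orthant.
        F y = matrix_inv (hessian (separable_sum \<phi>) y)"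
      using pos by eventually_elim (simp add: F)
    ultimately have "((\<lambda>y. matrix_inv (hessian (separable_sum \<phi>) y)) \<longlongrightarrow> F x)
        (at x within positive_orthant)"
      using tendsto_cong by force
    then show ?thesis
      using False nt by (simp add: inv_hessian_ext_def tendsto_Lim F_def)
  qed
qed

section \<open>Bregman distances\<close>

lemma strictly_convex_on_imp_convex_on:
  assumes "strictly_convex_on S g"
  shows "convex_on S g"
proof (intro convex_onI)
  fix t x y :: real
  assume "0 < t" "t < 1" "x \<in> S" "y \<in> S"
  then have "g ((1 - t) * x + t * y) < (1 - t) * g x + t * g y" if "x \<noteq> y"
    using assms that by (simp add: strictly_convex_on_def)
  then show "g ((1 - t) *\<^sub>R x + t *\<^sub>R y) \<le> (1 - t) * g x + t * g y"
    by (cases "x = y") (simp_all add: algebra_simps)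
qed (use assms in \<open>simp add: strictly_convex_on_def\<close>)

text \<open>
  A convex function lies above its tangents on the open half-line. At \<open>s = 0\<close> the inequality passes to
  the lower limit, which in particular is not \<open>- \<infinity>\<close>, so that the extended-real arithmetic in the
  Bregman distance is harmless even where the distance is infinite.
\<close>
lemma bregman_nonneg:
  assumes g: "convex_on {0<..} g" and t: "t > 0" and s: "s \<ge> 0"
    and D: "(g has_real_derivative deriv g t) (at t)"
  shows "0 \<le> bregman g s t"
proof -
  have tangent: "g t + deriv g t * (r - t) \<le> g r" if "r > 0" for r
  proof -
    have "g r - g t \<ge> deriv g t * (r - t)"
      by (rule convex_on_imp_above_tangent[OF g])
        (use that t D in \<open>auto simp: interior_open intro: has_field_derivative_at_within\<close>)
    then show ?thesis by simp
  qed
  have "ereal (g t + deriv g t * (s - t)) \<le> lsc_ext g s"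
  proof (cases "s = 0")
    case True
    have "((\<lambda>r. ereal (g t + deriv g t * (r - t))) \<longlongrightarrow> ereal (g t + deriv g t * (0 - t))) (at_right 0)"
      by (intro tendsto_intros)
    then have "ereal (g t + deriv g t * (0 - t))
        = Liminf (at_right 0) (\<lambda>r. ereal (g t + deriv g t * (r - t)))"
      by (intro lim_imp_Liminf[symmetric]) simp_all
    also have "\<dots> \<le> Liminf (at_right 0) (\<lambda>r. ereal (g r))"
      by (rule Liminf_mono) (use tangent in \<open>auto simp: eventually_at_filter\<close>)
    finally show ?thesis
      using True by (simp add: lsc_ext_def)
  next
    case False
    with s tangent[of s] show ?thesis by (simp add: lsc_ext_def)
  qed
  then show ?thesis
    by (cases "lsc_ext g s") (simp_all add: bregman_def)
qed

lemma bregman_self: "t > 0 \<Longrightarrow> bregman g t t = 0"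
  by (simp add: bregman_def lsc_ext_def)

lemma bregman_pos:
  "s > 0 \<Longrightarrow> bregman g s t = ereal (g s - g t - deriv g t * (s - t))"
  by (simp add: bregman_def lsc_ext_def)

section \<open>Optimality in a face of the orthant\<close>

text \<open>
  Split \<open>d\<close> orthogonally along \<open>W\<close>, the sum of the range of \<open>A\<^sup>T\<close> and the coordinate
  subspace of vectors vanishing on \<open>I\<close>. The component \<open>z\<close> orthogonal to \<open>W\<close> lies in the kernel of \<open>A\<close> and
  vanishes off \<open>I\<close>, so \<open>d\<close> annihilates it; as \<open>d \<bullet> z = z \<bullet> z\<close>, it is zero and \<open>d\<close> belongs to \<open>W\<close>.
\<close>
lemma annihilator_of_kernel_on_face:
  fixes A :: "real^'n^'m" and d :: "real^'n"
  assumes d: "\<And>v. A *v v = 0 \<Longrightarrow> (\<And>j. j \<notin> I \<Longrightarrow> v $ j = 0) \<Longrightarrow> d \<bullet> v = 0"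
  shows "\<exists>l. \<forall>i\<in>I. (d + transpose A *v l) $ i = 0"
proof -
  define W where "W = {transpose A *v l + u | l u. \<forall>i\<in>I. u $ i = 0}"
  have W: "transpose A *v l + u \<in> W" if "\<forall>i\<in>I. u $ i = 0" for l u
    using that by (auto simp: W_def)
  have "subspace W"
  proof (rule subspaceI)
    show "0 \<in> W" using W[of 0 0] by simp
  next
    fix p q assume "p \<in> W" "q \<in> W"
    then obtain l u l' u' where "p = transpose A *v l + u" "\<forall>i\<in>I. u $ i = 0"
      "q = transpose A *v l' + u'" "\<forall>i\<in>I. u' $ i = 0"
      by (auto simp: W_def)
    then show "p + q \<in> W"
      using W[of "u + u'" "l + l'"] by (simp add: matrix_vector_right_distrib add_ac)
  next
    fix c p assume "p \<in> W"
    then obtain l u where "p = transpose A *v l + u" "\<forall>i\<in>I. u $ i = 0"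
      by (auto simp: W_def)
    then show "c *\<^sub>R p \<in> W"
      using W[of "c *\<^sub>R u" "c *\<^sub>R l"]
      by (simp add: matrix_vector_mult_scaleR scaleR_right_distrib)
  qed
  then have span: "span W = W"
    by simp
  obtain w z where w: "w \<in> W" and z: "\<And>p. p \<in> W \<Longrightarrow> orthogonal z p" and dwz: "d = w + z"
    using orthogonal_subspace_decomp_exists[of W d] unfolding span by metis
  have "A *v z = 0"
  proof -
    have "(A *v z) \<bullet> (A *v z) = z \<bullet> (transpose A *v (A *v z))"
      by (simp add: dot_lmul_matrix[symmetric] inner_commute)
    also have "\<dots> = 0"
      using z[OF W[of 0 "A *v z"]] by (simp add: orthogonal_def)
    finally show ?thesis by simp
  qed
  moreover have "z $ j = 0" if "j \<notin> I" for j
  proof -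
    have "axis j 1 \<in> W"
      using that W[of "axis j 1" 0] by (force simp: axis_def)
    then show ?thesis
      using z[of "axis j 1"] by (simp add: orthogonal_def inner_axis)
  qed
  ultimately have "d \<bullet> z = 0"
    by (rule d)
  moreover have "w \<bullet> z = 0"
    using z[OF w] by (simp add: orthogonal_def inner_commute)
  ultimately have "z = 0"
    by (simp add: dwz inner_left_distrib)
  with w dwz obtain l u where "d = transpose A *v l + u" "\<forall>i\<in>I. u $ i = 0"
    by (auto simp: W_def)
  moreover have "transpose A *v (- l) = - (transpose A *v l)"
    using matrix_vector_mult_scaleR[of "transpose A" "-1" l] by simp
  ultimately have "\<forall>i\<in>I. (d + transpose A *v (- l)) $ i = 0"
    by simp
  then show ?thesis ..
qed

text \<open>
  The Karush-Kuhn-Tucker condition at the Bregman centre \<open>x\<close> itself. The step size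
  drops out because the distance term vanishes to first order at its centre.
\<close>
lemma is_arg_min_self_iff:
  fixes x d :: "real^'n" and A :: "real^'n^'m"
  assumes x: "\<And>i. 0 \<le> x $ i" and Ax: "A *v x = b" and \<eta>: "\<eta> > 0"
    and cvx: "\<And>i. convex_on {0<..} (\<phi> i)"
    and D: "\<And>i t. t > 0 \<Longrightarrow> (\<phi> i has_real_derivative deriv (\<phi> i) t) (at t)"
  shows "is_arg_min
      (\<lambda>y. ereal (d \<bullet> y) + ereal (1 / \<eta>) * (\<Sum>i\<in>{i. x $ i > 0}. bregman (\<phi> i) (y $ i) (x $ i)))
      (\<lambda>y. (\<forall>j. x $ j = 0 \<longrightarrow> y $ j = x $ j) \<and> A *v y = b \<and> (\<forall>i. 0 \<le> y $ i)) x
    \<longleftrightarrow> (\<exists>l. \<forall>i. x $ i > 0 \<longrightarrow> (d + transpose A *v l) $ i = 0)"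
    (is "is_arg_min ?h ?P x \<longleftrightarrow> _")
proof -
  have hx: "?h x = ereal (d \<bullet> x)"
    by (simp add: bregman_self)
  show ?thesis
  proof
    assume min: "is_arg_min ?h ?P x"
    have "d \<bullet> v = 0" if Av: "A *v v = 0" and v: "\<And>j. j \<notin> {i. x $ i > 0} \<Longrightarrow> v $ j = 0" for v
    proof -
      \<comment> \<open>The objective along the feasible line through \<open>x\<close>, as a real function; it is finite for
        small \<open>t\<close>, where the coordinates in the support of \<open>x\<close> stay positive.\<close>
      define k where "k t = d \<bullet> (x + t *\<^sub>R v) + 1 / \<eta> * (\<Sum>i\<in>{i. x $ i > 0}.
        \<phi> i (x $ i + t * v $ i) - \<phi> i (x $ i) - deriv (\<phi> i) (x $ i) * (t * v $ i))" for t
      have "\<forall>\<^sub>F t in nhds 0. k 0 \<le> k t"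
        using eventually_positive_coordinates[of "{i. x $ i > 0}" x v, simplified]
      proof eventually_elim
        case (elim t)
        have "0 \<le> (x + t *\<^sub>R v) $ i" for i
          using elim[rule_format, of i] x[of i] v[of i] by (cases "x $ i > 0") (auto simp: less_imp_le)
        then have "?P (x + t *\<^sub>R v)"
          using Ax Av v by (auto simp: matrix_vector_right_distrib matrix_vector_mult_scaleR)
        with min have "?h x \<le> ?h (x + t *\<^sub>R v)"
          by (auto simp: is_arg_min_def not_less)
        also have "?h (x + t *\<^sub>R v) = ereal (k t)"
          using elim by (simp add: k_def bregman_pos)
        also have "?h x = ereal (k 0)"
          unfolding hx by (simp add: k_def)
        finally show ?case by simp
      qed
      then obtain e where e: "e > 0" "\<And>t. \<bar>t\<bar> < e \<Longrightarrow> k 0 \<le> k t"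
        by (auto simp: eventually_nhds_metric dist_real_def)
      have chain: "((\<lambda>t. \<phi> i (x $ i + t * v $ i)) has_real_derivative deriv (\<phi> i) (x $ i) * v $ i) (at 0)"
        if "x $ i > 0" for i
      proof (rule DERIV_chain2[where f = "\<phi> i"])
        show "(\<phi> i has_real_derivative deriv (\<phi> i) (x $ i)) (at (x $ i + 0 * v $ i))"
          using D[OF that] by simp
      qed (auto intro!: derivative_eq_intros)
      have "((\<lambda>t. \<phi> i (x $ i + t * v $ i) - \<phi> i (x $ i) - deriv (\<phi> i) (x $ i) * (t * v $ i))
          has_real_derivative 0) (at 0)" if "i \<in> {i. x $ i > 0}" for i
        using that by (auto intro!: derivative_eq_intros chain)
      then have "((\<lambda>t. \<Sum>i\<in>{i. x $ i > 0}.
          \<phi> i (x $ i + t * v $ i) - \<phi> i (x $ i) - deriv (\<phi> i) (x $ i) * (t * v $ i))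
          has_real_derivative (\<Sum>i\<in>{i. x $ i > 0}. 0)) (at 0)"
        by (rule DERIV_sum)
      moreover have "((\<lambda>t. d \<bullet> (x + t *\<^sub>R v)) has_real_derivative d \<bullet> v) (at 0)"
        by (auto simp: inner_right_distrib intro!: derivative_eq_intros)
      ultimately have "(k has_real_derivative d \<bullet> v + 1 / \<eta> * (\<Sum>i\<in>{i. x $ i > 0}. 0)) (at 0)"
        unfolding k_def by (intro DERIV_add DERIV_cmult)
      then show "d \<bullet> v = 0"
        using DERIV_local_min[of k "d \<bullet> v" 0 e] e by simp
    qed
    then have "\<exists>l. \<forall>i\<in>{i. x $ i > 0}. (d + transpose A *v l) $ i = 0"
      by (rule annihilator_of_kernel_on_face)
    then show "\<exists>l. \<forall>i. x $ i > 0 \<longrightarrow> (d + transpose A *v l) $ i = 0"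
      by simp
  next
    assume "\<exists>l. \<forall>i. x $ i > 0 \<longrightarrow> (d + transpose A *v l) $ i = 0"
    then obtain l where l: "\<And>i. x $ i > 0 \<Longrightarrow> (d + transpose A *v l) $ i = 0"
      by blast
    have "?h x \<le> ?h y" if y: "?P y" for y
    proof -
      have "(d + transpose A *v l) \<bullet> (y - x) = 0"
        unfolding inner_vec_def
      proof (intro sum.neutral ballI)
        fix i
        show "inner ((d + transpose A *v l) $ i) ((y - x) $ i) = 0"
          using l[of i] x[of i] y by (cases "x $ i > 0") auto
      qed
      moreover have "(transpose A *v l) \<bullet> (y - x) = l \<bullet> (A *v (y - x))"
        by (simp add: dot_lmul_matrix)
      moreover have "A *v (y - x) = 0"
        using y Ax by (simp add: matrix_vector_mult_diff_distrib)
      ultimately have "d \<bullet> x = d \<bullet> y"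
        by (simp add: inner_left_distrib inner_diff_right)
      moreover have "0 \<le> ereal (1 / \<eta>) * (\<Sum>i\<in>{i. x $ i > 0}. bregman (\<phi> i) (y $ i) (x $ i))"
        using \<eta> y by (intro ereal_0_le_mult sum_nonneg bregman_nonneg cvx D) auto
      ultimately show ?thesis
        unfolding hx by (simp add: ereal_le_add_self)
    qed
    moreover have "?P x"
      using x Ax by simp
    ultimately show "is_arg_min ?h ?P x"
      unfolding is_arg_min_def not_less[symmetric] by blast
  qed
qed

section \<open>Fixed points and stable points\<close>

theorem proposition3p6:
  fixes f :: "real^'n \<Rightarrow> real"
    and A :: "real^'n^'m"
    and b :: "real^'m"
    and \<phi> :: "'n \<Rightarrow> real \<Rightarrow> real"
    and \<eta> :: real
  assumes "locally_lipschitz f"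
    and "rank A = CARD('m)"
    and "separable_kernel \<phi>"
    and "\<eta> > 0"
  shows "{x \<in> affine_constraint A b \<inter> closure positive_orthant. x \<in> ext_update \<phi> f A b \<eta> x}
    = stable_set \<phi> f A b"
proof -
  have diff: "\<And>i. (\<phi> i) differentiable_on {0<..}"
    and cvx: "\<And>i. convex_on {0<..} (\<phi> i)"
    using assms(3) by (auto simp: separable_kernel_def intro: strictly_convex_on_imp_convex_on)
  have D1: "(\<phi> i has_real_derivative deriv (\<phi> i) t) (at t)" if "t > 0" for i t
    using diff[of i] that
    by (auto simp: differentiable_on_eq_differentiable_at DERIV_deriv_iff_real_differentiable)
  from assms(3)[unfolded separable_kernel_def, THEN conjunct2]
  obtain \<gamma> \<psi> where \<gamma>: "\<gamma> > 0"
    and \<psi>: "\<And>i. continuous_on UNIV (\<psi> i)" "\<And>i t. \<psi> i t > 0"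
    and D2: "\<And>i t. t > 0 \<Longrightarrow> (deriv (\<phi> i) has_real_derivative t powr (- \<gamma>) * \<psi> i t) (at t)"
    by blast
  have "x \<in> ext_update \<phi> f A b \<eta> x \<longleftrightarrow> 0 \<in> (\<lambda>v. inv_hessian_ext \<phi> x *v v) `
      {d + w | d w. d \<in> clarke_subdiff f x \<and> w \<in> range (\<lambda>l. transpose A *v l)}"
    if "x \<in> affine_constraint A b \<inter> closure positive_orthant" for x
  proof -
    have x: "\<And>i. 0 \<le> x $ i" and Ax: "A *v x = b"
      using that by (auto simp: affine_constraint_def closure_positive_orthant)
    have ann: "inv_hessian_ext \<phi> x *v v = 0 \<longleftrightarrow> (\<forall>i. x $ i > 0 \<longrightarrow> v $ i = 0)" for v
    proof -
      have H: "inv_hessian_ext \<phi> x = (\<chi> i j. if i = j then (x $ i) powr \<gamma> / \<psi> i (x $ i) else 0)"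
        using x D1 D2 \<gamma> \<psi> by (rule inv_hessian_ext_eq)
      have "(inv_hessian_ext \<phi> x *v v) $ i = (x $ i) powr \<gamma> / \<psi> i (x $ i) * v $ i" for i
        unfolding H by (simp add: matrix_vector_mult_def if_distrib[of "\<lambda>c. c * _"] cong: if_cong)
      moreover have "\<psi> i (x $ i) \<noteq> 0" for i
        using \<psi>(2)[of i "x $ i"] by simp
      ultimately show ?thesis
        using x by (auto simp: vec_eq_iff less_le)
    qed
    have "x \<in> ext_update \<phi> f A b \<eta> x
        \<longleftrightarrow> (\<exists>d\<in>clarke_subdiff f x. \<exists>l. \<forall>i. x $ i > 0 \<longrightarrow> (d + transpose A *v l) $ i = 0)"
      unfolding ext_update_def mem_Collect_eq
      by (simp only: is_arg_min_self_iff[OF x Ax assms(4) cvx D1])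
    also have "\<dots> \<longleftrightarrow> (\<exists>d\<in>clarke_subdiff f x. \<exists>l. inv_hessian_ext \<phi> x *v (d + transpose A *v l) = 0)"
      unfolding ann ..
    also have "\<dots> \<longleftrightarrow> 0 \<in> (\<lambda>v. inv_hessian_ext \<phi> x *v v) `
        {d + w | d w. d \<in> clarke_subdiff f x \<and> w \<in> range (\<lambda>l. transpose A *v l)}"
      by (force simp: image_iff)
    finally show ?thesis .
  qed
  then show ?thesis
    unfolding stable_set_def by blast
qed

end
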